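(* Let $x_0<a<b<x_1$ be real numbers and let $f\in C^2(]x_0,x_1[)$ be real-valued. Let $\Pi_{[a,b]}(f)$ be the interpolation polynomial of degree at most one given by $$\Pi_{[a,b]}(f)(x)=\frac{x-b}{a-b}f(a)+\frac{x-a}{b-a}f(b).$$ Then $$\forall x\in[a,b]:\quad |\Pi_{[a,b]}(f)(x)-f(x)|\le\frac{(b-a)}{4}\|f'\|_\infty+\frac{(b-a)^2}{16}\|f''\|_\infty.$$
   Context: $\|\cdot\|_\infty$ denotes the $L^\infty$ norm on $[a,b]$. *)

theory Defs
  imports "HOL-Analysis.Analysis" "HOL-Probability.Essential_Supremum"
begin

text \<open>\<open>C\<^sup>2\<close> on an open set \<open>S\<close>; the derivatives are then \<open>deriv f\<close> and \<open>deriv (deriv f)\<close>.\<close>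
definition C2_on :: "real set \<Rightarrow> (real \<Rightarrow> real) \<Rightarrow> bool" where
  "C2_on S f \<longleftrightarrow>
     (\<forall>x\<in>S. f field_differentiable (at x)) \<and>
     (\<forall>x\<in>S. deriv f field_differentiable (at x)) \<and>
     continuous_on S (deriv (deriv f))"

definition linear_interp :: "real \<Rightarrow> real \<Rightarrow> (real \<Rightarrow> real) \<Rightarrow> real \<Rightarrow> real" where
  "linear_interp a b f x = (x - b) / (a - b) * f a + (x - a) / (b - a) * f b"

text \<open>Extended-real valued, so that an essentially unbounded function has norm \<open>\<infinity>\<close>.
  Only the values of \<open>g\<close> on \<open>{a..b}\<close> matter.\<close>
definition Linf_norm :: "real \<Rightarrow> real \<Rightarrow> (real \<Rightarrow> real) \<Rightarrow> ereal" where
  "Linf_norm a b g = esssup (lebesgue_on {a..b}) (\<lambda>x. ereal \<bar>g x\<bar>)"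

end

theory Submission
  imports Defs
begin

text \<open>
  Write \<open>h = b - a\<close>, and let \<open>M\<^sub>1\<close> and \<open>M\<^sub>2\<close> be the maxima of \<open>\<bar>f'\<bar>\<close> and \<open>\<bar>f''\<bar>\<close> on \<open>[a, b]\<close>.
  The interpolation error at \<open>x\<close> is the convex combination
  \<open>((b - x) / h) (f a - f x) + ((x - a) / h) (f b - f x)\<close>.
  It has two independent bounds. The mean value theorem, applied to both differences, gives
  \<open>2 M\<^sub>1 (x - a) (b - x) / h \<le> h M\<^sub>1 / 2\<close>.
  Second-order Taylor expansion about \<open>x\<close>, where the first-order terms cancel, gives
  \<open>M\<^sub>2 (x - a) (b - x) / 2 \<le> h\<^sup>2 M\<^sub>2 / 8\<close>.
  The claimed estimate is the average of the two. That the maxima may be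
  replaced by the essential suprema rests on the continuity of \<open>f'\<close> and \<open>f''\<close>: an exceptional
  null set cannot contain an interval, so an almost everywhere bound holds everywhere.
\<close>

lemma linear_interp_error:
  assumes "a < b"
  shows "linear_interp a b f x - f x =
    ((b - x) * (f a - f x) + (x - a) * (f b - f x)) / (b - a)"
proof -
  have "(x - b) / (a - b) = (b - x) / (b - a)"
    using assms by (simp add: divide_simps algebra_simps)
  then have "linear_interp a b f x = ((b - x) * f a + (x - a) * f b) / (b - a)"
    by (simp add: linear_interp_def add_divide_distrib)
  also have "\<dots> - f x = ((b - x) * f a + (x - a) * f b - (b - a) * f x) / (b - a)"
    using assms by (simp add: diff_divide_distrib)
  also have "(b - x) * f a + (x - a) * f b - (b - a) * f x =
      (b - x) * (f a - f x) + (x - a) * (f b - f x)"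
    by (simp add: algebra_simps)
  finally show ?thesis .
qed

lemma mult_distances_to_endpoints_le:
  fixes a b x :: real
  shows "(x - a) * (b - x) \<le> (b - a)\<^sup>2 / 4"
  using zero_le_power2[of "2 * x - a - b"] by (simp add: power2_eq_square algebra_simps)

lemma linear_interp_error_le_deriv:
  assumes ab: "a < b" and x: "x \<in> {a..b}"
    and deriv: "\<And>y. y \<in> {a..b} \<Longrightarrow> (f has_real_derivative f' y) (at y)"
    and bound: "\<And>y. y \<in> {a..b} \<Longrightarrow> \<bar>f' y\<bar> \<le> M"
  shows "\<bar>linear_interp a b f x - f x\<bar> \<le> (b - a) / 2 * M"
proof -
  have lip: "\<bar>f y - f x\<bar> \<le> M * \<bar>y - x\<bar>" if "y \<in> {a..b}" for y
    using field_differentiable_bound[of "{a..b}" f f' M y x] deriv bound x that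
    by (auto intro: has_field_derivative_at_within)
  have M: "0 \<le> M"
    using bound[OF x] by linarith
  have "\<bar>(b - x) * (f a - f x) + (x - a) * (f b - f x)\<bar>
      \<le> (b - x) * \<bar>f a - f x\<bar> + (x - a) * \<bar>f b - f x\<bar>"
    using x by (intro order_trans[OF abs_triangle_ineq]) (simp add: abs_mult)
  also have "\<dots> \<le> (b - x) * (M * \<bar>a - x\<bar>) + (x - a) * (M * \<bar>b - x\<bar>)"
    using x ab by (intro add_mono mult_left_mono lip) auto
  also have "\<dots> = 2 * M * ((x - a) * (b - x))"
    using x by (simp add: algebra_simps)
  also have "\<dots> \<le> 2 * M * ((b - a)\<^sup>2 / 4)"
    using M by (intro mult_left_mono mult_distances_to_endpoints_le) auto
  also have "\<dots> = (b - a) / 2 * M * (b - a)"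
    by (simp add: power2_eq_square)
  finally show ?thesis
    using ab by (simp add: linear_interp_error abs_divide pos_divide_le_eq)
qed

lemma first_order_Taylor_remainder_le:
  fixes f f' f'' :: "real \<Rightarrow> real"
  assumes x: "x \<in> {a..b}" and y: "y \<in> {a..b}"
    and deriv1: "\<And>t. t \<in> {a..b} \<Longrightarrow> (f has_real_derivative f' t) (at t)"
    and deriv2: "\<And>t. t \<in> {a..b} \<Longrightarrow> (f' has_real_derivative f'' t) (at t)"
    and bound: "\<And>t. t \<in> {a..b} \<Longrightarrow> \<bar>f'' t\<bar> \<le> M"
  shows "\<bar>f y - f x - f' x * (y - x)\<bar> \<le> M * (y - x)\<^sup>2 / 2"
proof (cases "y = x")
  case False
  define D where "D = (\<lambda>n::nat. if n = 0 then f else if n = 1 then f' else f'')"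
  have "\<exists>t. (if y < x then y < t \<and> t < x else x < t \<and> t < y) \<and>
      f y = (\<Sum>m<2. D m x / fact m * (y - x) ^ m) + D 2 t / fact 2 * (y - x) ^ 2"
    using x y False deriv1 deriv2
    by (intro Taylor[where a = a and b = b]) (auto simp: D_def less_2_cases_iff)
  then obtain t where t: "if y < x then y < t \<and> t < x else x < t \<and> t < y"
    and eq: "f y = (\<Sum>m<2. D m x / fact m * (y - x) ^ m) + D 2 t / fact 2 * (y - x) ^ 2"
    by blast
  have "f y - f x - f' x * (y - x) = f'' t * (y - x)\<^sup>2 / 2"
    using eq by (simp add: D_def numeral_2_eq_2)
  moreover have "t \<in> {a..b}"
    using t x y by (auto split: if_splits)
  ultimately show ?thesis
    using mult_right_mono[OF bound zero_le_power2, of t "y - x"]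
    by (simp only: abs_divide abs_mult abs_power2) simp
qed simp

lemma linear_interp_error_le_deriv2:
  assumes ab: "a < b" and x: "x \<in> {a..b}"
    and deriv1: "\<And>y. y \<in> {a..b} \<Longrightarrow> (f has_real_derivative f' y) (at y)"
    and deriv2: "\<And>y. y \<in> {a..b} \<Longrightarrow> (f' has_real_derivative f'' y) (at y)"
    and bound: "\<And>y. y \<in> {a..b} \<Longrightarrow> \<bar>f'' y\<bar> \<le> M"
  shows "\<bar>linear_interp a b f x - f x\<bar> \<le> (b - a)\<^sup>2 / 8 * M"
proof -
  define R where "R y = f y - f x - f' x * (y - x)" for y
  have R: "\<bar>R y\<bar> \<le> M * (y - x)\<^sup>2 / 2" if "y \<in> {a..b}" for y
    unfolding R_def using first_order_Taylor_remainder_le[OF x that deriv1 deriv2 bound] .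
  have M: "0 \<le> M"
    using bound[OF x] by linarith
  \<comment> \<open>The terms with \<open>f' x\<close> cancel because \<open>(b - x) (a - x) + (x - a) (b - x) = 0\<close>.\<close>
  have "(b - x) * (f a - f x) + (x - a) * (f b - f x) = (b - x) * R a + (x - a) * R b"
    by (simp add: R_def algebra_simps)
  also have "\<bar>\<dots>\<bar> \<le> (b - x) * \<bar>R a\<bar> + (x - a) * \<bar>R b\<bar>"
    using x by (intro order_trans[OF abs_triangle_ineq]) (simp add: abs_mult)
  also have "\<dots> \<le> (b - x) * (M * (a - x)\<^sup>2 / 2) + (x - a) * (M * (b - x)\<^sup>2 / 2)"
    using x ab by (intro add_mono mult_left_mono R) auto
  also have "\<dots> = M * (b - a) / 2 * ((x - a) * (b - x))"
    by (simp add: power2_eq_square field_simps)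
  also have "\<dots> \<le> M * (b - a) / 2 * ((b - a)\<^sup>2 / 4)"
    using M ab by (intro mult_left_mono mult_distances_to_endpoints_le) auto
  also have "\<dots> = (b - a)\<^sup>2 / 8 * M * (b - a)"
    by simp
  finally show ?thesis
    using ab by (simp add: linear_interp_error abs_divide pos_divide_le_eq)
qed

text \<open>
  The set of points of \<open>{a..b}\<close> where the almost everywhere bound holds is closed by continuity,
  and its complement in \<open>{a..b}\<close> is null, so it contains the open interval and hence its closure.
\<close>

lemma abs_le_Linf_norm:
  assumes ab: "a < b" and cont: "continuous_on {a..b} g" and x: "x \<in> {a..b}"
  shows "ereal \<bar>g x\<bar> \<le> Linf_norm a b g"
proof -
  define C where "C = {y \<in> {a..b}. ereal \<bar>g y\<bar> \<le> Linf_norm a b g}"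
  have cont_ereal: "continuous_on {a..b} (\<lambda>y. ereal \<bar>g y\<bar>)"
    using cont by (intro continuous_intros)
  have "C = (\<lambda>y. ereal \<bar>g y\<bar>) -` {..Linf_norm a b g} \<inter> {a..b}"
    by (auto simp: C_def)
  then have "closed C"
    using cont_ereal by (simp add: continuous_on_closed_vimage)
  have "AE y in lebesgue_on {a..b}. ereal \<bar>g y\<bar> \<le> Linf_norm a b g"
    unfolding Linf_norm_def by (rule esssup_AE)
  then have "AE y in lebesgue. y \<in> {a..b} \<longrightarrow> ereal \<bar>g y\<bar> \<le> Linf_norm a b g"
    by (simp add: AE_restrict_space_iff)
  then have "AE y \<in> {a<..<b} in lebesgue. y \<in> C"
    by eventually_elim (simp add: C_def)
  then have "{a<..<b} \<subseteq> C"
    using mem_closed_if_AE_lebesgue_open[OF open_greaterThanLessThan \<open>closed C\<close>] by blast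
  then have "closure {a<..<b} \<subseteq> C"
    using \<open>closed C\<close> by (rule closure_minimal)
  then show ?thesis
    using x ab by (auto simp: C_def)
qed

text \<open>
  A real bound avoids case distinctions on infinite norms: it is the value of \<open>\<bar>g\<bar>\<close> at a point
  where the maximum is attained.
\<close>

lemma continuous_bounded_below_Linf_norm:
  assumes ab: "a < b" and cont: "continuous_on {a..b} g"
  obtains M where "\<And>y. y \<in> {a..b} \<Longrightarrow> \<bar>g y\<bar> \<le> M" "ereal M \<le> Linf_norm a b g"
proof -
  have "continuous_on {a..b} (\<lambda>y. \<bar>g y\<bar>)"
    using cont by (intro continuous_intros)
  then obtain p where "p \<in> {a..b}" "\<forall>y\<in>{a..b}. \<bar>g y\<bar> \<le> \<bar>g p\<bar>"
    using continuous_attains_sup[of "{a..b}" "\<lambda>y. \<bar>g y\<bar>"] ab by auto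
  then show thesis
    using that abs_le_Linf_norm[OF ab cont] by blast
qed

theorem lemma3p1:
  fixes x0 a b x1 :: real and f :: "real \<Rightarrow> real"
  assumes "x0 < a" and "a < b" and "b < x1"
    and "C2_on {x0<..<x1} f"
  shows "\<forall>x\<in>{a..b}.
    ereal \<bar>linear_interp a b f x - f x\<bar> \<le>
      ereal ((b - a) / 4) * Linf_norm a b (deriv f) +
      ereal ((b - a)^2 / 16) * Linf_norm a b (deriv (deriv f))"
proof
  fix x assume x: "x \<in> {a..b}"
  have sub: "{a..b} \<subseteq> {x0<..<x1}"
    using assms by auto
  have deriv1: "(f has_real_derivative deriv f y) (at y)"
    and deriv2: "(deriv f has_real_derivative deriv (deriv f) y) (at y)" if "y \<in> {a..b}" for y
    using assms(4) sub that
    by (auto simp: C2_on_def field_differentiable_derivI)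
  have cont1: "continuous_on {a..b} (deriv f)"
    using deriv2 by (meson DERIV_isCont continuous_at_imp_continuous_on)
  have cont2: "continuous_on {a..b} (deriv (deriv f))"
    using assms(4) sub by (auto simp: C2_on_def intro: continuous_on_subset)
  obtain M1 where M1: "\<And>y. y \<in> {a..b} \<Longrightarrow> \<bar>deriv f y\<bar> \<le> M1"
    and M1_le: "ereal M1 \<le> Linf_norm a b (deriv f)"
    using continuous_bounded_below_Linf_norm[OF \<open>a < b\<close> cont1] by blast
  obtain M2 where M2: "\<And>y. y \<in> {a..b} \<Longrightarrow> \<bar>deriv (deriv f) y\<bar> \<le> M2"
    and M2_le: "ereal M2 \<le> Linf_norm a b (deriv (deriv f))"
    using continuous_bounded_below_Linf_norm[OF \<open>a < b\<close> cont2] by blast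
  have "\<bar>linear_interp a b f x - f x\<bar> \<le> (b - a) / 4 * M1 + (b - a)^2 / 16 * M2"
    using linear_interp_error_le_deriv[OF \<open>a < b\<close> x deriv1 M1]
      linear_interp_error_le_deriv2[OF \<open>a < b\<close> x deriv1 deriv2 M2]
    by simp
  then have "ereal \<bar>linear_interp a b f x - f x\<bar> \<le>
      ereal ((b - a) / 4) * ereal M1 + ereal ((b - a)^2 / 16) * ereal M2"
    by simp
  also have "\<dots> \<le> ereal ((b - a) / 4) * Linf_norm a b (deriv f) +
      ereal ((b - a)^2 / 16) * Linf_norm a b (deriv (deriv f))"
    using M1_le M2_le \<open>a < b\<close> by (intro add_mono ereal_mult_left_mono) auto
  finally show "ereal \<bar>linear_interp a b f x - f x\<bar> \<le>
      ereal ((b - a) / 4) * Linf_norm a b (deriv f) +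
      ereal ((b - a)^2 / 16) * Linf_norm a b (deriv (deriv f))" .
qed

end
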